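(* Let $n\ge 3$. The number of isomorphism classes of zero-divisor semigroups corresponding to the complete graph $K_n$ is $$\sum_{k=1}^{n}\sum_{t=0}^{n-k} p(n-t,k)+1,$$ where $p(j,i)$ denotes the number of integer tuples $(d_1,\dots,d_i)$ with $d_1+d_2+\cdots+d_i=j$ and $1\le d_1\le d_2\le\cdots\le d_i$.
   Context: All semigroups are commutative, written multiplicatively, with a zero element $0$ satisfying $0x=0$ for all $x$. An element $x$ of such a semigroup $S$ is a zero-divisor if $xy=0$ for some nonzero $y\in S$. A zero-divisor semigroup is a commutative semigroup with zero all of whose elements are zero-divisors. For a zero-divisor semigroup $S$, $\Gamma(S)$ is the simple undirected graph with vertex set $S\setminus\{0\}$ in which distinct vertices $x\neq y$ are joined by an edge exactly when $xy=0$. A zero-divisor semigroup $S$ corresponds to a graph $G$ if $\Gamma(S)\cong G$. $K_n$ denotes the complete graph on $n$ vertices. *)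

theory Defs
  imports "HOL-Algebra.Congruence" "Graph_Theory.Graph_Theory"
begin

text \<open>The \<^const>\<open>carrier\<close> field is the underlying set; the values of the product
  outside the carrier carry no information and are never referred to.\<close>

record 'a zero_semigroup = "'a partial_object" +
  mul :: "'a \<Rightarrow> 'a \<Rightarrow> 'a" (infixl \<open>\<cdot>\<index>\<close> 70)
  zer :: 'a (\<open>\<zero>\<index>\<close>)

locale comm_semigroup_with_zero =
  fixes S :: "('a, 'm) zero_semigroup_scheme" (structure)
  assumes mul_closed: "\<lbrakk>x \<in> carrier S; y \<in> carrier S\<rbrakk> \<Longrightarrow> x \<cdot> y \<in> carrier S"
    and zero_closed: "\<zero> \<in> carrier S"
    and mul_assoc: "\<lbrakk>x \<in> carrier S; y \<in> carrier S; z \<in> carrier S\<rbrakk> \<Longrightarrow> (x \<cdot> y) \<cdot> z = x \<cdot> (y \<cdot> z)"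
    and mul_comm: "\<lbrakk>x \<in> carrier S; y \<in> carrier S\<rbrakk> \<Longrightarrow> x \<cdot> y = y \<cdot> x"
    and zero_mul: "x \<in> carrier S \<Longrightarrow> \<zero> \<cdot> x = \<zero>"

definition zero_divisor :: "('a, 'm) zero_semigroup_scheme \<Rightarrow> 'a \<Rightarrow> bool" where
  "zero_divisor S x \<longleftrightarrow> x \<in> carrier S \<and> (\<exists>y \<in> carrier S. y \<noteq> \<zero>\<^bsub>S\<^esub> \<and> x \<cdot>\<^bsub>S\<^esub> y = \<zero>\<^bsub>S\<^esub>)"

locale zero_divisor_semigroup = comm_semigroup_with_zero +
  assumes all_zero_divisors: "x \<in> carrier S \<Longrightarrow> zero_divisor S x"

text \<open>An undirected simple graph is encoded, as in the library, by a loop-free symmetric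
  digraph: the edge joining \<open>x\<close> and \<open>y\<close> is the pair of arcs \<open>(x, y)\<close>, \<open>(y, x)\<close>.\<close>

definition zero_divisor_graph :: "('a, 'm) zero_semigroup_scheme \<Rightarrow> 'a pair_pre_digraph" where
  "zero_divisor_graph S =
     \<lparr> pverts = carrier S - {\<zero>\<^bsub>S\<^esub>},
       parcs = {(x, y). x \<in> carrier S - {\<zero>\<^bsub>S\<^esub>} \<and> y \<in> carrier S - {\<zero>\<^bsub>S\<^esub>} \<and>
                        x \<noteq> y \<and> x \<cdot>\<^bsub>S\<^esub> y = \<zero>\<^bsub>S\<^esub>} \<rparr>"

definition corresponds_to :: "('a, 'm) zero_semigroup_scheme \<Rightarrow> ('v, 'e) pre_digraph \<Rightarrow> bool" where
  "corresponds_to S G \<longleftrightarrow> digraph_iso (with_proj (zero_divisor_graph S)) G"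

text \<open>Preservation of zero need not be required: a surjective multiplicative map sends
  zero to zero.\<close>

definition semigroup_iso ::
  "('a, 'm) zero_semigroup_scheme \<Rightarrow> ('b, 'n) zero_semigroup_scheme \<Rightarrow> bool" where
  "semigroup_iso S T \<longleftrightarrow>
     (\<exists>h. bij_betw h (carrier S) (carrier T) \<and>
          (\<forall>x \<in> carrier S. \<forall>y \<in> carrier S. h (x \<cdot>\<^bsub>S\<^esub> y) = h x \<cdot>\<^bsub>T\<^esub> h y))"

text \<open>There is no type of all semigroups, so isomorphism classes are formed among the structures
  whose elements lie in one type \<open>'a\<close>. If \<open>'a\<close> has at least \<open>m\<close> elements, every semigroup of
  order \<open>m\<close> has an isomorphic copy there, and no isomorphism class of that order is missed.\<close>

definition iso_rel :: "'a zero_semigroup set \<Rightarrow> 'a zero_semigroup rel" where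
  "iso_rel A = {(S, T). S \<in> A \<and> T \<in> A \<and> semigroup_iso S T}"

definition iso_classes :: "'a zero_semigroup set \<Rightarrow> 'a zero_semigroup set set" where
  "iso_classes A = A // iso_rel A"

text \<open>The condition \<open>sorted (1 # d)\<close> reads \<open>1 \<le> d\<^sub>1 \<le> d\<^sub>2 \<le> \<dots> \<le> d\<^sub>i\<close>.\<close>

definition num_partitions :: "nat \<Rightarrow> nat \<Rightarrow> nat" where
  "num_partitions j i =
     card {d :: int list. length d = i \<and> sum_list d = int j \<and> sorted (1 # d)}"

lemma equiv_iso_rel:
  assumes "\<And>S. S \<in> A \<Longrightarrow> zero_divisor_semigroup S"
  shows "equiv A (iso_rel A)"
proof (rule equivI)
  show "iso_rel A \<subseteq> A \<times> A" by (auto simp: iso_rel_def)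
  show "refl_on A (iso_rel A)"
    by (auto simp: refl_on_def iso_rel_def semigroup_iso_def intro!: exI[of _ id])
  show "sym (iso_rel A)"
  proof (rule symI)
    fix S T assume "(S, T) \<in> iso_rel A"
    then obtain h where S: "S \<in> A" and T: "T \<in> A"
      and bij: "bij_betw h (carrier S) (carrier T)"
      and hom: "\<And>x y. x \<in> carrier S \<Longrightarrow> y \<in> carrier S \<Longrightarrow> h (x \<cdot>\<^bsub>S\<^esub> y) = h x \<cdot>\<^bsub>T\<^esub> h y"
      by (auto simp: iso_rel_def semigroup_iso_def)
    interpret S: zero_divisor_semigroup S by (rule assms[OF S])
    let ?g = "the_inv_into (carrier S) h"
    have g: "bij_betw ?g (carrier T) (carrier S)" by (rule bij_betw_the_inv_into[OF bij])
    have "?g (x \<cdot>\<^bsub>T\<^esub> y) = ?g x \<cdot>\<^bsub>S\<^esub> ?g y" if "x \<in> carrier T" "y \<in> carrier T" for x y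
    proof (rule the_inv_into_f_eq)
      have mem: "?g x \<in> carrier S" "?g y \<in> carrier S" using g that by (auto dest: bij_betwE)
      show "inj_on h (carrier S)" using bij by (rule bij_betw_imp_inj_on)
      show "?g x \<cdot>\<^bsub>S\<^esub> ?g y \<in> carrier S" using mem by (rule S.mul_closed)
      show "h (?g x \<cdot>\<^bsub>S\<^esub> ?g y) = x \<cdot>\<^bsub>T\<^esub> y"
        using hom[OF mem] that by (simp add: f_the_inv_into_f_bij_betw[OF bij])
    qed
    with g S T show "(T, S) \<in> iso_rel A"
      unfolding iso_rel_def semigroup_iso_def by blast
  qed
  show "trans (iso_rel A)"
  proof (rule transI)
    fix S T U assume "(S, T) \<in> iso_rel A" "(T, U) \<in> iso_rel A"
    then obtain h k where "S \<in> A" "U \<in> A"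
      and bij: "bij_betw h (carrier S) (carrier T)" "bij_betw k (carrier T) (carrier U)"
      and hom: "\<And>x y. x \<in> carrier S \<Longrightarrow> y \<in> carrier S \<Longrightarrow> h (x \<cdot>\<^bsub>S\<^esub> y) = h x \<cdot>\<^bsub>T\<^esub> h y"
        "\<And>x y. x \<in> carrier T \<Longrightarrow> y \<in> carrier T \<Longrightarrow> k (x \<cdot>\<^bsub>T\<^esub> y) = k x \<cdot>\<^bsub>U\<^esub> k y"
      by (auto simp: iso_rel_def semigroup_iso_def)
    moreover have "(k \<circ> h) (x \<cdot>\<^bsub>S\<^esub> y) = (k \<circ> h) x \<cdot>\<^bsub>U\<^esub> (k \<circ> h) y"
      if "x \<in> carrier S" "y \<in> carrier S" for x y
      using that hom bij by (auto dest: bij_betwE)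
    ultimately show "(S, U) \<in> iso_rel A"
      unfolding iso_rel_def semigroup_iso_def using bij_betw_trans[OF bij] by blast
  qed
qed

end

theory Submission
  imports Defs "HOL-Combinatorics.Permutations"
begin

text \<open>
  In a semigroup corresponding to \<open>K\<^sub>n\<close> products of distinct elements vanish, so the semigroup is
  determined by its squaring map \<open>s\<close>, and associativity says exactly that \<open>s x = x\<close> or
  \<open>s (s x) = 0\<close> for each \<open>x\<close>. The nonzero elements that are not idempotent therefore split into
  blocks \<open>{x. x = y \<or> s x = y}\<close>, one for each \<open>y \<noteq> 0\<close> with \<open>s y = 0\<close>, and the multiset of block
  sizes is a complete isomorphism invariant. With \<open>t\<close> idempotents and \<open>k\<close> blocks it is an arbitrary
  partition of \<open>n - t\<close> into \<open>k\<close> parts; the extra 1 is the case \<open>k = 0\<close>, where every element is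
  idempotent.
\<close>

section \<open>Complete graphs up to isomorphism\<close>

text \<open>Any bijection \<open>h\<close> between the vertex sets will do. The arcs of
  \<open>G\<close> have an arbitrary type, so a matching arc map \<open>k\<close> must be chosen as
  well; it is bijective because neither graph has parallel arcs.\<close>

lemma digraph_iso_complete_digraph:
  assumes G: "complete_digraph n G" and P: "complete_digraph n P"
  shows "digraph_iso P G"
proof -
  interpret G: graph G using G by (simp add: complete_digraph_def)
  interpret P: graph P using P by (simp add: complete_digraph_def)
  have Pends: "arcs_ends P = {(u, v). (u, v) \<in> verts P \<times> verts P \<and> u \<noteq> v}"
    and Gends: "arcs_ends G = {(u, v). (u, v) \<in> verts G \<times> verts G \<and> u \<noteq> v}"
    and cards: "card (verts P) = card (verts G)"
    using G P by (auto simp: complete_digraph_def)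
  obtain h where h: "bij_betw h (verts P) (verts G)"
    using finite_same_card_bij[OF P.finite_verts G.finite_verts cards] by blast
  have inj: "h u = h v \<longleftrightarrow> u = v" if "u \<in> verts P" "v \<in> verts P" for u v
    using h that by (auto simp: bij_betw_def inj_on_def)
  \<comment> \<open>The ends of \<open>a\<close> are distinct, hence so are their images under
    \<open>h\<close>, and in a complete graph distinct vertices are joined.\<close>
  have "\<exists>b \<in> arcs G. tail G b = h (tail P a) \<and> head G b = h (head P a)"
    if a: "a \<in> arcs P" for a
  proof -
    have "(h (tail P a), h (head P a)) \<in> arcs_ends G"
      using a h P.no_loops[OF a] inj unfolding Gends by (auto dest: bij_betwE)
    then show ?thesis by (auto simp: arcs_ends_def arc_to_ends_def)
  qed
  then obtain k where k: "\<And>a. a \<in> arcs P \<Longrightarrow> k a \<in> arcs G"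
      "\<And>a. a \<in> arcs P \<Longrightarrow> tail G (k a) = h (tail P a)"
      "\<And>a. a \<in> arcs P \<Longrightarrow> head G (k a) = h (head P a)"
    by metis
  have kinj: "inj_on k (arcs P)"
  proof (rule inj_onI)
    fix a b assume ab: "a \<in> arcs P" "b \<in> arcs P" "k a = k b"
    then have "h (tail P a) = h (tail P b)" "h (head P a) = h (head P b)"
      by (metis k(2), metis k(3))
    then show "a = b"
      using ab inj by (intro P.no_multi_arcs) (auto simp: arc_to_ends_def)
  qed
  have "k ` arcs P = arcs G"
  proof (intro equalityI subsetI)
    fix b assume b: "b \<in> arcs G"
    then obtain u v where uv: "u \<in> verts P" "v \<in> verts P" "h u = tail G b" "h v = head G b"
      using h G.tail_in_verts[OF b] G.head_in_verts[OF b] unfolding bij_betw_def by (metis imageE)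
    then have "(u, v) \<in> arcs_ends P"
      using G.no_loops[OF b] unfolding Pends by auto
    then obtain a where a: "a \<in> arcs P" "tail P a = u" "head P a = v"
      by (auto simp: arcs_ends_def arc_to_ends_def)
    then have "k a = b"
      using b uv k by (intro G.no_multi_arcs) (auto simp: arc_to_ends_def)
    with a show "b \<in> k ` arcs P" by blast
  qed (use k in auto)
  then show ?thesis
    unfolding digraph_iso_def
    using h k kinj P.wf_digraph_axioms
    by (intro exI[of _ "\<lparr>iso_verts = h, iso_arcs = k, iso_head = head G, iso_tail = tail G\<rparr>"])
      (auto simp: P.digraph_isomorphism_def app_iso_def bij_betw_def)
qed

text \<open>Completeness is pulled back along an isomorphism. With the preceding lemma this turns
  correspondence to \<open>G\<close> into completeness of the zero-divisor graph. In
  \<open>with_proj P\<close> an arc is its pair of ends, so it suffices to determine the set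
  \<open>parcs P\<close>.\<close>

lemma complete_digraph_iso_cong:
  assumes iso: "digraph_iso (with_proj P) G" and G: "complete_digraph n G"
  shows "complete_digraph n (with_proj P)"
proof -
  interpret G: graph G using G by (simp add: complete_digraph_def)
  obtain f where f: "pre_digraph.digraph_isomorphism (with_proj P) f" and Gf: "G = app_iso f (with_proj P)"
    using iso unfolding digraph_iso_def by blast
  have wf: "wf_digraph (with_proj P)" and inj: "inj_on (iso_verts f) (pverts P)"
    and ends: "\<And>a. a \<in> parcs P \<Longrightarrow> iso_verts f (fst a) = tail G (iso_arcs f a)"
      "\<And>a. a \<in> parcs P \<Longrightarrow> iso_verts f (snd a) = head G (iso_arcs f a)"
    using f by (auto simp: pre_digraph.digraph_isomorphism_def Gf)
  have mem: "fst a \<in> pverts P \<and> snd a \<in> pverts P" if "a \<in> parcs P" for a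
    using wf_digraph.tail_in_verts[OF wf, of a] wf_digraph.head_in_verts[OF wf, of a] that by simp
  have V: "verts G = iso_verts f ` pverts P" "arcs G = iso_arcs f ` parcs P"
    by (simp_all add: Gf)
  have Gends: "arcs_ends G = {(u, v). (u, v) \<in> verts G \<times> verts G \<and> u \<noteq> v}"
    and card: "card (verts G) = n"
    using G by (auto simp: complete_digraph_def)
  have "parcs P = {(u, v). (u, v) \<in> pverts P \<times> pverts P \<and> u \<noteq> v}"
  proof (intro equalityI subsetI)
    fix a assume a: "a \<in> parcs P"
    then have "tail G (iso_arcs f a) \<noteq> head G (iso_arcs f a)"
      by (intro G.no_loops) (simp add: V)
    then show "a \<in> {(u, v). (u, v) \<in> pverts P \<times> pverts P \<and> u \<noteq> v}"
      using ends[OF a] mem[OF a] by (cases a) auto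
  next
    fix a assume a: "a \<in> {(u, v). (u, v) \<in> pverts P \<times> pverts P \<and> u \<noteq> v}"
    then obtain u v where uv: "a = (u, v)" "u \<in> pverts P" "v \<in> pverts P" "u \<noteq> v" by blast
    then have "(iso_verts f u, iso_verts f v) \<in> arcs_ends G"
      unfolding Gends V using inj by (auto dest: inj_onD)
    then obtain b where b: "b \<in> parcs P" "tail G (iso_arcs f b) = iso_verts f u"
        "head G (iso_arcs f b) = iso_verts f v"
      by (auto simp: arcs_ends_def arc_to_ends_def V)
    then have "b = (u, v)"
      using ends[OF b(1)] mem[OF b(1)] inj uv by (cases b) (auto dest: inj_onD)
    with b uv show "a \<in> parcs P" by simp
  qed
  moreover have "finite (pverts P)" "card (pverts P) = n"
    using G.finite_verts card inj by (auto simp: V finite_image_iff card_image)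
  ultimately show ?thesis by (simp add: complete_digraph_pair_def)
qed

section \<open>Semigroups of complete graphs and their squaring maps\<close>

text \<open>A graph-free form of correspondence to the complete graph on \<open>n\<close> vertices.
  The carrier has \<open>n + 1\<close> elements because zero is not a vertex.\<close>

definition clique_semigroup :: "nat \<Rightarrow> ('a, 'm) zero_semigroup_scheme \<Rightarrow> bool" where
  "clique_semigroup n S \<longleftrightarrow> zero_divisor_semigroup S \<and> finite (carrier S) \<and> card (carrier S) = n + 1 \<and>
     (\<forall>x \<in> carrier S. \<forall>y \<in> carrier S. x \<noteq> y \<longrightarrow> x \<cdot>\<^bsub>S\<^esub> y = \<zero>\<^bsub>S\<^esub>)"

lemma clique_semigroup_iff:
  assumes G: "complete_digraph n G"
  shows "zero_divisor_semigroup S \<and> corresponds_to S G \<longleftrightarrow> clique_semigroup n S"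
proof (cases "zero_divisor_semigroup S")
  case True
  then interpret zero_divisor_semigroup S .
  have zero_mul': "x \<cdot>\<^bsub>S\<^esub> \<zero>\<^bsub>S\<^esub> = \<zero>\<^bsub>S\<^esub>" if "x \<in> carrier S" for x
    using that mul_comm zero_mul zero_closed by metis
  have "corresponds_to S G \<longleftrightarrow> complete_digraph n (with_proj (zero_divisor_graph S))"
    unfolding corresponds_to_def
    using digraph_iso_complete_digraph[OF G] complete_digraph_iso_cong[OF _ G] by blast
  also have "\<dots> \<longleftrightarrow> finite (carrier S - {\<zero>\<^bsub>S\<^esub>}) \<and> card (carrier S - {\<zero>\<^bsub>S\<^esub>}) = n \<and>
      (\<forall>x \<in> carrier S - {\<zero>\<^bsub>S\<^esub>}. \<forall>y \<in> carrier S - {\<zero>\<^bsub>S\<^esub>}. x \<noteq> y \<longrightarrow> x \<cdot>\<^bsub>S\<^esub> y = \<zero>\<^bsub>S\<^esub>)"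
    unfolding complete_digraph_pair_def zero_divisor_graph_def by auto
  \<comment> \<open>Letting \<open>x\<close> or \<open>y\<close> be zero adds no condition, since
    such products vanish anyway.\<close>
  also have "(\<forall>x \<in> carrier S - {\<zero>\<^bsub>S\<^esub>}. \<forall>y \<in> carrier S - {\<zero>\<^bsub>S\<^esub>}. x \<noteq> y \<longrightarrow> x \<cdot>\<^bsub>S\<^esub> y = \<zero>\<^bsub>S\<^esub>) \<longleftrightarrow>
      (\<forall>x \<in> carrier S. \<forall>y \<in> carrier S. x \<noteq> y \<longrightarrow> x \<cdot>\<^bsub>S\<^esub> y = \<zero>\<^bsub>S\<^esub>)"
    using zero_mul zero_mul' by blast
  also have "finite (carrier S - {\<zero>\<^bsub>S\<^esub>}) \<longleftrightarrow> finite (carrier S)"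
    by simp
  finally show ?thesis
    using True card.remove[OF _ zero_closed] unfolding clique_semigroup_def by auto
qed (simp add: clique_semigroup_def)

definition squaring_map :: "'a set \<Rightarrow> 'a \<Rightarrow> ('a \<Rightarrow> 'a) \<Rightarrow> bool" where
  "squaring_map C z s \<longleftrightarrow> finite C \<and> z \<in> C \<and> s z = z \<and> (\<forall>x \<in> C. s x \<in> C \<and> (s x = x \<or> s (s x) = z))"

text \<open>If \<open>x\<close> differs from its square, the two are distinct elements, so their
  product, the cube of \<open>x\<close>, is zero; then the fourth power is zero too.\<close>

lemma squaring_map_square:
  assumes "clique_semigroup n S"
  shows "squaring_map (carrier S) \<zero>\<^bsub>S\<^esub> (\<lambda>x. x \<cdot>\<^bsub>S\<^esub> x)"
proof -
  interpret zero_divisor_semigroup S using assms by (simp add: clique_semigroup_def)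
  have "(x \<cdot>\<^bsub>S\<^esub> x) \<cdot>\<^bsub>S\<^esub> (x \<cdot>\<^bsub>S\<^esub> x) = \<zero>\<^bsub>S\<^esub>" if x: "x \<in> carrier S" and ne: "x \<cdot>\<^bsub>S\<^esub> x \<noteq> x" for x
  proof -
    have "x \<cdot>\<^bsub>S\<^esub> (x \<cdot>\<^bsub>S\<^esub> x) = \<zero>\<^bsub>S\<^esub>"
      using assms x ne mul_closed unfolding clique_semigroup_def by metis
    then show ?thesis
      using x mul_assoc mul_comm mul_closed zero_closed zero_mul by metis
  qed
  then show ?thesis
    using assms zero_closed zero_mul mul_closed unfolding squaring_map_def clique_semigroup_def by blast
qed

text \<open>Up to order, the only critical triples for associativity are \<open>x, x, w\<close> with
  \<open>s x = w \<noteq> x\<close>, where the law reads \<open>s (s x) = z\<close>. As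
  \<open>C\<close> has at least three elements, each \<open>x\<close> has some element outside
  \<open>{x, z}\<close>, and that element annihilates it.\<close>

lemma clique_semigroup_of_squaring_map:
  assumes s: "squaring_map C z s" and card: "card C = n + 1" and n: "n \<ge> 2"
  shows "clique_semigroup n \<lparr>carrier = C, mul = (\<lambda>x y. if x = y then s x else z), zer = z\<rparr>"
proof -
  have fin: "finite C" and z: "z \<in> C" "s z = z" and
    C: "\<And>x. x \<in> C \<Longrightarrow> s x \<in> C" and sq: "\<And>x. x \<in> C \<Longrightarrow> s x = x \<or> s (s x) = z"
    using s by (auto simp: squaring_map_def)
  let ?S = "\<lparr>carrier = C, mul = (\<lambda>x y. if x = y then s x else z), zer = z\<rparr>"
  have "comm_semigroup_with_zero ?S"
    by unfold_locales (use z C sq in \<open>auto split: if_splits\<close>, (metis z sq)+)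
  moreover have "zero_divisor ?S x" if x: "x \<in> C" for x
  proof -
    have "card {x, z} < card C"
      using card n by (simp add: card_insert_if)
    then have "\<not> C \<subseteq> {x, z}"
      using card_mono[of "{x, z}" C] by auto
    then show ?thesis using x unfolding zero_divisor_def by auto
  qed
  ultimately show ?thesis
    using fin card
    by (simp add: clique_semigroup_def zero_divisor_semigroup_def zero_divisor_semigroup_axioms_def)
qed

text \<open>A bijection keeps distinct elements distinct, and their products are zero on both sides.
  Only zero and the squares are left to compare.\<close>

lemma semigroup_iso_clique_iff:
  assumes S: "clique_semigroup n S" and T: "clique_semigroup n T"
  shows "semigroup_iso S T \<longleftrightarrow>
    (\<exists>h. bij_betw h (carrier S) (carrier T) \<and> h \<zero>\<^bsub>S\<^esub> = \<zero>\<^bsub>T\<^esub> \<and>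
         (\<forall>x \<in> carrier S. h (x \<cdot>\<^bsub>S\<^esub> x) = h x \<cdot>\<^bsub>T\<^esub> h x))"
    (is "_ \<longleftrightarrow> (\<exists>h. ?iso h)")
proof -
  interpret S: zero_divisor_semigroup S using S by (simp add: clique_semigroup_def)
  interpret T: zero_divisor_semigroup T using T by (simp add: clique_semigroup_def)
  have "h \<zero>\<^bsub>S\<^esub> = \<zero>\<^bsub>T\<^esub>" if bij: "bij_betw h (carrier S) (carrier T)"
    and hom: "\<forall>x \<in> carrier S. \<forall>y \<in> carrier S. h (x \<cdot>\<^bsub>S\<^esub> y) = h x \<cdot>\<^bsub>T\<^esub> h y" for h
  proof -
    \<comment> \<open>A preimage \<open>x\<close> of the zero of \<open>T\<close> forces
      \<open>h\<close> to preserve zero: zero is also the product of \<open>x\<close> with zero, and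
      \<open>h\<close> sends that product to a multiple of the zero of \<open>T\<close>.\<close>
    obtain x where x: "x \<in> carrier S" "h x = \<zero>\<^bsub>T\<^esub>"
      using bij T.zero_closed by (metis bij_betw_imp_surj_on imageE)
    have "h (x \<cdot>\<^bsub>S\<^esub> \<zero>\<^bsub>S\<^esub>) = \<zero>\<^bsub>T\<^esub>"
      using hom x S.zero_closed T.zero_mul bij by (metis bij_betwE)
    then show ?thesis using x S.mul_comm S.zero_mul S.zero_closed by metis
  qed
  moreover have "h (x \<cdot>\<^bsub>S\<^esub> y) = h x \<cdot>\<^bsub>T\<^esub> h y"
    if h: "?iso h" and x: "x \<in> carrier S" and y: "y \<in> carrier S" for h x y
  proof (cases "x = y")
    case False
    then have "h x \<noteq> h y" "h x \<in> carrier T" "h y \<in> carrier T"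
      using h x y by (auto simp: bij_betw_def inj_on_def)
    then show ?thesis
      using S T h x y False by (simp add: clique_semigroup_def)
  qed (use h x in simp)
  ultimately show ?thesis unfolding semigroup_iso_def by blast
qed

section \<open>Block sizes as a complete invariant\<close>

text \<open>The alternative \<open>x = y\<close> puts \<open>y\<close> into its own block, as
  \<open>s y = z \<noteq> y\<close>; so every size is positive. Nonzero fixed points of
  \<open>s\<close> lie in no block.\<close>

definition block_sizes :: "'a set \<Rightarrow> 'a \<Rightarrow> ('a \<Rightarrow> 'a) \<Rightarrow> nat multiset" where
  "block_sizes C z s =
     image_mset (\<lambda>y. card {x \<in> C - {z}. x = y \<or> s x = y}) (mset_set {y \<in> C - {z}. s y = z})"

lemma bij_betw_Collect:
  assumes "bij_betw h A B" and "\<And>x. x \<in> A \<Longrightarrow> Q (h x) \<longleftrightarrow> P x"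
  shows "bij_betw h {x \<in> A. P x} {y \<in> B. Q y}"
  using assms unfolding bij_betw_def by (auto simp: inj_on_def)

text \<open>An isomorphism \<open>h\<close> carries the elements that index blocks, and each block,
  onto their counterparts.\<close>

lemma block_sizes_cong:
  assumes s: "squaring_map C z s" and r: "squaring_map D w r"
    and h: "bij_betw h C D" "h z = w" and comm: "\<And>x. x \<in> C \<Longrightarrow> h (s x) = r (h x)"
  shows "block_sizes C z s = block_sizes D w r"
proof -
  have zC: "z \<in> C" and C: "\<And>x. x \<in> C \<Longrightarrow> s x \<in> C"
    using s by (auto simp: squaring_map_def)
  have inj: "h x = h y \<longleftrightarrow> x = y" if "x \<in> C" "y \<in> C" for x y
    using h that by (auto simp: bij_betw_def inj_on_def)
  have h': "bij_betw h (C - {z}) (D - {w})"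
    using bij_betw_Collect[OF h(1), of "\<lambda>y. y \<noteq> w" "\<lambda>x. x \<noteq> z"] h(2) inj[OF _ zC]
    by (simp add: set_diff_eq)
  have bij: "bij_betw h {y \<in> C - {z}. s y = z} {y \<in> D - {w}. r y = w}"
    using comm inj C zC h(2) by (intro bij_betw_Collect[OF h']) (metis DiffD1)
  have "card {x \<in> C - {z}. x = y \<or> s x = y} = card {x \<in> D - {w}. x = h y \<or> r x = h y}"
    if "y \<in> C" for y
    using comm inj C that
    by (intro bij_betw_same_card[of h] bij_betw_Collect[OF h']) (metis DiffD1)
  then have "block_sizes C z s
      = image_mset (\<lambda>y. card {x \<in> D - {w}. x = h y \<or> r x = h y}) (mset_set {y \<in> C - {z}. s y = z})"
    using s unfolding block_sizes_def squaring_map_def by (intro image_mset_cong) auto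
  also have "\<dots> = image_mset (\<lambda>y. card {x \<in> D - {w}. x = y \<or> r x = y})
      (image_mset h (mset_set {y \<in> C - {z}. s y = z}))"
    by (simp add: image_mset.compositionality comp_def)
  also have "image_mset h (mset_set {y \<in> C - {z}. s y = z}) = mset_set {y \<in> D - {w}. r y = w}"
    using bij by (simp add: image_mset_mset_set bij_betw_def)
  finally show ?thesis by (simp add: block_sizes_def)
qed

text \<open>An arbitrary bijection \<open>k\<close> moves the problem to the single set
  \<open>A\<close>, where equal image multisets differ by a permutation \<open>p\<close>; then
  \<open>k \<circ> p\<close> is the required map.\<close>

lemma image_mset_eq_imp_bij_betw:
  assumes "finite A" "finite B" "image_mset f (mset_set A) = image_mset g (mset_set B)"
  shows "\<exists>h. bij_betw h A B \<and> (\<forall>x \<in> A. g (h x) = f x)"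
proof -
  have "card A = card B"
    using assms(3) by (metis size_image_mset size_mset_set)
  then obtain k where k: "bij_betw k A B"
    using assms finite_same_card_bij by blast
  have "image_mset f (mset_set A) = image_mset (g \<circ> k) (mset_set A)"
    using assms(3) k by (simp add: bij_betw_def image_mset_mset_set flip: image_mset.compositionality)
  then obtain p where p: "p permutes A" "\<forall>x \<in> A. f x = (g \<circ> k) (p x)"
    using image_mset_eq_implies_permutes[OF assms(1)] by blast
  then show ?thesis
    using bij_betw_trans[OF permutes_imp_bij[OF p(1)] k] by (intro exI[of _ "k \<circ> p"]) simp
qed

text \<open>The isomorphism is glued from bijections on three kinds of nonzero elements: first match
  the blocks by size, then the members inside matched blocks, and finally the idempotents.\<close>

lemma squaring_map_iso_of_block_sizes:
  assumes s: "squaring_map C z s" and r: "squaring_map D w r" and card: "card C = card D"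
    and eq: "block_sizes C z s = block_sizes D w r"
  shows "\<exists>h. bij_betw h C D \<and> h z = w \<and> (\<forall>x \<in> C. h (s x) = r (h x))"
proof -
  have fC: "finite C" and zC: "z \<in> C" "s z = z" and sC: "\<And>x. x \<in> C \<Longrightarrow> s x \<in> C"
    and sq: "\<And>x. x \<in> C \<Longrightarrow> s x = x \<or> s (s x) = z"
    using s by (auto simp: squaring_map_def)
  have fD: "finite D" and wD: "w \<in> D" "r w = w" and rD: "\<And>x. x \<in> D \<Longrightarrow> r x \<in> D"
    and rq: "\<And>x. x \<in> D \<Longrightarrow> r x = x \<or> r (r x) = w"
    using r by (auto simp: squaring_map_def)
  \<comment> \<open>\<open>Z\<close> holds the nonzero elements with square zero, \<open>E\<close>
    the nonzero idempotents, and \<open>N\<close> all others; \<open>z\<close> is not in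
    \<open>N\<close> because \<open>s z = z\<close>. Squares of elements of \<open>N\<close> lie in
    \<open>Z\<close>.\<close>
  define Z N E where "Z = {y \<in> C - {z}. s y = z}" and "N = {x \<in> C. s x \<noteq> x \<and> s x \<noteq> z}"
    and "E = {x \<in> C - {z}. s x = x}"
  define Z' N' E' where "Z' = {y \<in> D - {w}. r y = w}" and "N' = {x \<in> D. r x \<noteq> x \<and> r x \<noteq> w}"
    and "E' = {x \<in> D - {w}. r x = x}"
  note C_defs = Z_def N_def E_def and D_defs = Z'_def N'_def E'_def
  have finite: "finite Z" "finite N" "finite E" "finite Z'" "finite N'" "finite E'"
    using fC fD by (auto simp: C_defs D_defs)
  have C_eq: "C = insert z (Z \<union> N \<union> E)" and D_eq: "D = insert w (Z' \<union> N' \<union> E')"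
    using zC wD by (auto simp: C_defs D_defs)
  have disj: "Z \<inter> N = {}" "(Z \<union> N) \<inter> E = {}" "z \<notin> Z \<union> N \<union> E"
      "Z' \<inter> N' = {}" "(Z' \<union> N') \<inter> E' = {}" "w \<notin> Z' \<union> N' \<union> E'"
    using zC wD by (auto simp: C_defs D_defs)
  have sN: "s x \<in> Z" if "x \<in> N" for x
    using that sC sq unfolding C_defs by auto
  have rN: "r x \<in> Z'" if "x \<in> N'" for x
    using that rD rq unfolding D_defs by auto
  obtain f where f: "bij_betw f Z Z'"
    and f_sizes: "\<And>y. y \<in> Z \<Longrightarrow>
      card {x \<in> D - {w}. x = f y \<or> r x = f y} = card {x \<in> C - {z}. x = y \<or> s x = y}"
    using image_mset_eq_imp_bij_betw[OF finite(1,4) eq[unfolded block_sizes_def, folded Z_def Z'_def]]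
    by blast
  have f_inj: "f x = f y \<longleftrightarrow> x = y" if "x \<in> Z" "y \<in> Z" for x y
    using f that by (auto simp: bij_betw_def inj_on_def)
  have fZ: "f y \<in> Z'" if "y \<in> Z" for y
    using f that by (auto dest: bij_betwE)
  \<comment> \<open>The successor accounts for \<open>y\<close> itself, which is not in
    \<open>N\<close>.\<close>
  have block_C: "card {x \<in> C - {z}. x = y \<or> s x = y} = Suc (card {x \<in> N. s x = y})" if "y \<in> Z" for y
  proof -
    have "{x \<in> C - {z}. x = y \<or> s x = y} = insert y {x \<in> N. s x = y}" "y \<notin> {x \<in> N. s x = y}"
      using that zC by (auto simp: C_defs)
    then show ?thesis using finite by simp
  qed
  have block_D: "card {x \<in> D - {w}. x = y \<or> r x = y} = Suc (card {x \<in> N'. r x = y})" if "y \<in> Z'" for y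
  proof -
    have "{x \<in> D - {w}. x = y \<or> r x = y} = insert y {x \<in> N'. r x = y}" "y \<notin> {x \<in> N'. r x = y}"
      using that wD by (auto simp: D_defs)
    then show ?thesis using finite by simp
  qed
  \<comment> \<open>For \<open>v = f y\<close> the fibres to compare are the blocks of
    \<open>y\<close> and \<open>v\<close> without \<open>y\<close> and \<open>v\<close>, and
    \<open>f\<close> preserves block sizes; for \<open>v\<close> outside \<open>Z'\<close> both
    fibres are empty. The resulting \<open>g\<close> commutes with squaring on
    \<open>N\<close>.\<close>
  have "image_mset (\<lambda>x. f (s x)) (mset_set N) = image_mset r (mset_set N')"
  proof (rule multiset_eqI)
    fix v
    have "card {x \<in> N. f (s x) = v} = card {x \<in> N'. r x = v}"
    proof (cases "v \<in> Z'")
      case True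
      then obtain y where y: "y \<in> Z" "v = f y"
        using f by (auto simp: bij_betw_def)
      then have "{x \<in> N. f (s x) = v} = {x \<in> N. s x = y}"
        using f_inj sN by auto
      then show ?thesis
        using f_sizes[OF y(1)] block_C[OF y(1)] block_D[OF True] y by simp
    next
      case False
      then have "{x \<in> N. f (s x) = v} = {}" "{x \<in> N'. r x = v} = {}"
        using sN rN fZ by auto
      then show ?thesis by (simp only: card.empty)
    qed
    then show "count (image_mset (\<lambda>x. f (s x)) (mset_set N)) v = count (image_mset r (mset_set N')) v"
      using finite by (simp add: count_image_mset' conj_commute eq_commute)
  qed
  then obtain g where g: "bij_betw g N N'" "\<And>x. x \<in> N \<Longrightarrow> r (g x) = f (s x)"
    using image_mset_eq_imp_bij_betw[OF finite(2,5)] by blast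
  \<comment> \<open>The number of idempotents is what remains of the common size of \<open>C\<close>
    and \<open>D\<close>. They carry no further structure, so any bijection \<open>e\<close>
    serves.\<close>
  have "card Z = card Z'" "card N = card N'"
    using f g by (auto intro: bij_betw_same_card)
  moreover have "card C = Suc (card Z + card N + card E)" "card D = Suc (card Z' + card N' + card E')"
    using finite disj by (simp_all add: C_eq D_eq card_Un_disjoint)
  ultimately have "card E = card E'"
    using card by simp
  then obtain e where e: "bij_betw e E E'"
    using finite_same_card_bij finite by blast
  define h where "h x = (if x = z then w else if x \<in> Z then f x else if x \<in> N then g x else e x)" for x
  have h_simps: "h z = w" "\<And>x. x \<in> Z \<Longrightarrow> h x = f x" "\<And>x. x \<in> N \<Longrightarrow> h x = g x" "\<And>x. x \<in> E \<Longrightarrow> h x = e x"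
    using disj by (auto simp: h_def)
  have "bij_betw h Z Z'" "bij_betw h N N'" "bij_betw h E E'"
    using f g(1) e h_simps by (auto cong: bij_betw_cong)
  then have "bij_betw h (Z \<union> N \<union> E) (Z' \<union> N' \<union> E')"
    using disj by (auto intro!: bij_betw_combine)
  then have "bij_betw h C D"
    unfolding C_eq D_eq using h_simps(1) disj
    by (metis notIn_Un_bij_betw3 Un_insert_right sup_bot_right)
  moreover have "h (s x) = r (h x)" if x: "x \<in> C" for x
  proof -
    consider "x = z" | "x \<in> Z" | "x \<in> N" | "x \<in> E"
      using x C_eq by blast
    then show ?thesis
    proof cases
      case 2
      then show ?thesis using fZ[of x] h_simps by (auto simp: Z_def Z'_def)
    next
      case 3
      then show ?thesis using g h_simps sN by simp
    next
      case 4
      then have "e x \<in> E'" using e by (auto dest: bij_betwE)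
      with 4 h_simps(4)[of x] show ?thesis by (simp add: E_def E'_def)
    qed (use zC wD h_simps in simp)
  qed
  ultimately show ?thesis using h_simps(1) by blast
qed

section \<open>The multisets that occur as block sizes\<close>

text \<open>Each block contains its index \<open>y\<close>, and the blocks are pairwise disjoint
  subsets of \<open>C - {z}\<close>, which has \<open>n\<close> elements.\<close>

lemma block_sizes_admissible:
  assumes s: "squaring_map C z s" and card: "card C = n + 1"
  shows "0 \<notin># block_sizes C z s" and "sum_mset (block_sizes C z s) \<le> n"
proof -
  have fin: "finite C" and z: "z \<in> C"
    using s by (auto simp: squaring_map_def)
  show "0 \<notin># block_sizes C z s"
    using fin by (auto simp: block_sizes_def card_eq_0_iff)
  have "sum_mset (block_sizes C z s) =
      (\<Sum>y \<in> {y \<in> C - {z}. s y = z}. card {x \<in> C - {z}. x = y \<or> s x = y})"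
    by (simp add: block_sizes_def sum_unfold_sum_mset)
  also have "\<dots> = card (\<Union>y \<in> {y \<in> C - {z}. s y = z}. {x \<in> C - {z}. x = y \<or> s x = y})"
    using fin by (subst card_UN_disjoint) auto
  also have "\<dots> \<le> card (C - {z})"
    using fin by (intro card_mono) auto
  finally show "sum_mset (block_sizes C z s) \<le> n"
    using z fin card by simp
qed

text \<open>Blocks are cut off from \<open>V\<close> one at a time, by induction on
  \<open>M\<close>. The elements left over at the end become idempotents, so the sum of
  \<open>M\<close> may be smaller than \<open>card V\<close>.\<close>

lemma ex_squaring_map_block_sizes:
  assumes "finite V" "z \<notin> V" "0 \<notin># M" "sum_mset M \<le> card V"
  shows "\<exists>s. squaring_map (insert z V) z s \<and> block_sizes (insert z V) z s = M"
  using assms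
proof (induction M arbitrary: V)
  case empty
  have "{y \<in> insert z V - {z}. y = z} = {}" by auto
  then have "block_sizes (insert z V) z (\<lambda>y. y) = {#}"
    by (simp only: block_sizes_def mset_set.empty image_mset_empty)
  with empty show ?case
    by (intro exI[of _ "\<lambda>y. y"]) (auto simp: squaring_map_def)
next
  case (add d M)
  obtain W where W: "W \<subseteq> V" "card W = d" "finite W"
    using obtain_subset_with_card_n[of d V] add.prems by auto
  then have "W \<noteq> {}" using add.prems by auto
  then obtain w where w: "w \<in> W" by blast
  define U where "U = V - W"
  have U: "finite U" "z \<notin> U" "W \<inter> U = {}" "V = W \<union> U" "z \<notin> W" "card U = card V - d"
    using W add.prems by (auto simp: U_def card_Diff_subset)
  obtain s where s: "squaring_map (insert z U) z s" "block_sizes (insert z U) z s = M"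
  proof -
    have "0 \<notin># M" "sum_mset M \<le> card U"
      using add.prems U(6) by simp_all
    then show ?thesis using add.IH[OF U(1,2)] that by blast
  qed
  have s': "s z = z" "\<And>x. x \<in> U \<Longrightarrow> s x \<in> insert z U" "\<And>x. x \<in> U \<Longrightarrow> s x = x \<or> s (s x) = z"
    using s(1) by (auto simp: squaring_map_def)
  \<comment> \<open>The new block is \<open>W\<close>: its index \<open>w\<close> squares to
    \<open>z\<close> and its other elements square to \<open>w\<close>. On the remaining elements
    \<open>r\<close> agrees with \<open>s\<close>.\<close>
  define r where "r x = (if x = w then z else if x \<in> W then w else s x)" for x
  have r: "r w = z" "\<And>x. x \<in> W - {w} \<Longrightarrow> r x = w" "\<And>x. x \<in> U \<Longrightarrow> r x = s x" "r z = z"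
    using U(3,5) w s'(1) by (auto simp: r_def)
  have wz: "w \<noteq> z" "w \<notin> U" using w U by auto
  have "squaring_map (insert z V) z r"
    unfolding squaring_map_def
  proof (intro conjI ballI)
    fix x assume "x \<in> insert z V"
    then consider "x = z" | "x = w" | "x \<in> W - {w}" | "x \<in> U" using U(4) by blast
    then show "r x \<in> insert z V" "r x = x \<or> r (r x) = z"
      using r s' w U(4) by (cases; fastforce)+
  qed (use r add.prems in auto)
  moreover have "block_sizes (insert z V) z r = add_mset d M"
  proof -
    have V': "insert z V - {z} = V" "insert z U - {z} = U"
      using add.prems U by auto
    have nil: "{y \<in> V. r y = z} = insert w {y \<in> U. s y = z}"
      using r w wz U by auto
    have "{x \<in> V. x = w \<or> r x = w} = W"
      using r w wz U s'(2) by (auto; metis insertE)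
    \<comment> \<open>Old blocks do not grow, since \<open>r\<close> maps \<open>W\<close> into
      \<open>{z, w}\<close>, which is disjoint from \<open>U\<close>.\<close>
    moreover have "{x \<in> V. x = y \<or> r x = y} = {x \<in> U. x = y \<or> s x = y}" if "y \<in> U" for y
    proof -
      have "y \<noteq> z" "y \<noteq> w" "y \<notin> W" using that U wz by auto
      then show ?thesis using r U(4) that
        by (auto; metis DiffI singletonD)
    qed
    then have "image_mset (\<lambda>y. card {x \<in> V. x = y \<or> r x = y}) (mset_set {y \<in> U. s y = z}) = M"
      unfolding s(2)[symmetric] block_sizes_def V' using U(1)
      by (intro image_mset_cong) auto
    ultimately show ?thesis
      using U(1) W(2) wz(2) by (simp add: block_sizes_def V' nil)
  qed
  ultimately show ?case by blast
qed

section \<open>Counting partitions\<close>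

definition partitions_into :: "nat \<Rightarrow> nat \<Rightarrow> nat multiset set" where
  "partitions_into j k = {M. 0 \<notin># M \<and> sum_mset M = j \<and> size M = k}"

lemma size_le_sum_mset: "0 \<notin># M \<Longrightarrow> size M \<le> sum_mset M" for M :: "nat multiset"
  by (induction M) auto

lemma finite_partitions_into: "finite (partitions_into j k)"
proof (rule finite_subset)
  show "partitions_into j k \<subseteq> mset ` {xs. set xs \<subseteq> {..j} \<and> length xs = k}"
  proof
    fix M assume M: "M \<in> partitions_into j k"
    obtain xs where xs: "mset xs = M" using ex_mset by blast
    with M have "set xs \<subseteq> {..j}" "length xs = k"
      by (auto simp: partitions_into_def sum_mset_sum_list member_le_sum_list)
    with xs show "M \<in> mset ` {xs. set xs \<subseteq> {..j} \<and> length xs = k}" by blast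
  qed
qed (simp add: finite_lists_length_eq)

text \<open>Sorting is inverse to forgetting the order of a list; the rest is conversion between
  integer and natural entries.\<close>

lemma num_partitions_eq_card: "num_partitions j k = card (partitions_into j k)"
proof -
  \<comment> \<open>Positive integers survive the passage through \<open>nat\<close>; the bound
    comes from \<open>sorted (1 # d)\<close>.\<close>
  have pos: "image_mset int (image_mset nat M) = M" if "\<forall>x \<in># M. 1 \<le> x" for M
    using that by (induction M) auto
  have sums: "sum_mset (image_mset int M) = int (sum_mset M)" for M
    by (induction M) auto
  have "bij_betw (\<lambda>d. image_mset nat (mset d))
      {d :: int list. length d = k \<and> sum_list d = int j \<and> sorted (1 # d)} (partitions_into j k)"
  proof (rule bij_betw_byWitness[where f' = "\<lambda>M. sorted_list_of_multiset (image_mset int M)"])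
    show "\<forall>d \<in> {d. length d = k \<and> sum_list d = int j \<and> sorted (1 # d)}.
        sorted_list_of_multiset (image_mset int (image_mset nat (mset d))) = d"
      using pos by (auto simp: sorted_sort_id simp del: multiset.map_comp)
    show "\<forall>M \<in> partitions_into j k.
        image_mset nat (mset (sorted_list_of_multiset (image_mset int M))) = M"
      by (simp add: multiset.map_comp comp_def)
    show "(\<lambda>d. image_mset nat (mset d)) ` {d. length d = k \<and> sum_list d = int j \<and> sorted (1 # d)}
        \<subseteq> partitions_into j k"
    proof (intro image_subsetI)
      fix d :: "int list" assume d: "d \<in> {d. length d = k \<and> sum_list d = int j \<and> sorted (1 # d)}"
      then have "int (sum_mset (image_mset nat (mset d))) = int j"
        using pos[of "mset d"] sums[of "image_mset nat (mset d)"] by (simp add: sum_mset_sum_list)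
      then have "sum_mset (image_mset nat (mset d)) = j"
        by (simp only: of_nat_eq_iff)
      then show "image_mset nat (mset d) \<in> partitions_into j k"
        using d by (auto simp: partitions_into_def)
    qed
    show "(\<lambda>M. sorted_list_of_multiset (image_mset int M)) ` partitions_into j k
        \<subseteq> {d. length d = k \<and> sum_list d = int j \<and> sorted (1 # d)}"
    proof (intro image_subsetI)
      fix M assume M: "M \<in> partitions_into j k"
      have "length (sorted_list_of_multiset (image_mset int M)) = k"
        using M by (simp add: partitions_into_def flip: size_mset)
      moreover have "sum_list (sorted_list_of_multiset (image_mset int M)) = int j"
      proof -
        have "sum_list (sorted_list_of_multiset (image_mset int M)) = sum_mset (image_mset int M)"
          by (simp flip: sum_mset_sum_list)
        also note sums
        finally show ?thesis using M by (simp only: partitions_into_def mem_Collect_eq)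
      qed
      moreover have "\<forall>x \<in># M. 1 \<le> int x"
        using M by (metis (mono_tags, lifting) One_nat_def Suc_leI gr0I mem_Collect_eq of_nat_1 of_nat_le_iff partitions_into_def)
      ultimately show "sorted_list_of_multiset (image_mset int M)
          \<in> {d. length d = k \<and> sum_list d = int j \<and> sorted (1 # d)}" by auto
    qed
  qed
  then show ?thesis unfolding num_partitions_def by (rule bij_betw_same_card)
qed

text \<open>Multisets are sorted by their size \<open>k\<close> and by the deficit
  \<open>t = n - sum_mset M\<close>, which in the application is the number of nonzero idempotents.
  The empty multiset has \<open>k = 0\<close> and supplies the extra 1.\<close>

lemma card_bounded_partitions:
  "card {M :: nat multiset. 0 \<notin># M \<and> sum_mset M \<le> n}
     = (\<Sum>k = 1..n. \<Sum>t = 0..n - k. num_partitions (n - t) k) + 1"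
proof -
  have "{M. 0 \<notin># M \<and> sum_mset M \<le> n} = insert {#} (\<Union>k \<in> {1..n}. \<Union>t \<in> {0..n - k}. partitions_into (n - t) k)"
  proof (intro equalityI subsetI)
    fix M assume M: "M \<in> {M. 0 \<notin># M \<and> sum_mset M \<le> n}"
    \<comment> \<open>Parts are positive, so a multiset of size \<open>k\<close> has deficit at most
      \<open>n - k\<close>: this is the upper limit of the inner sum.\<close>
    then have "size M \<le> sum_mset M" by (simp add: size_le_sum_mset)
    with M have "M \<in> partitions_into (n - (n - sum_mset M)) (size M)" "n - sum_mset M \<in> {0..n - size M}"
      "size M \<le> n"
      by (auto simp: partitions_into_def)
    moreover have "M = {#} \<or> 1 \<le> size M"
      by (cases M) auto
    ultimately show "M \<in> insert {#} (\<Union>k \<in> {1..n}. \<Union>t \<in> {0..n - k}. partitions_into (n - t) k)"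
      by force
  qed (auto simp: partitions_into_def)
  moreover have "{#} \<notin> (\<Union>k \<in> {1..n}. \<Union>t \<in> {0..n - k}. partitions_into (n - t) k)"
    by (auto simp: partitions_into_def)
  \<comment> \<open>The unions are disjoint, because \<open>M\<close> determines \<open>k\<close> as
    its size and, as \<open>t \<le> n\<close>, also \<open>t\<close> from its sum.\<close>
  moreover have "card (\<Union>k \<in> {1..n}. \<Union>t \<in> {0..n - k}. partitions_into (n - t) k)
      = (\<Sum>k = 1..n. card (\<Union>t \<in> {0..n - k}. partitions_into (n - t) k))"
    by (rule card_UN_disjoint) (auto simp: finite_partitions_into, auto simp: partitions_into_def)
  moreover have "card (\<Union>t \<in> {0..n - k}. partitions_into (n - t) k)
      = (\<Sum>t = 0..n - k. card (partitions_into (n - t) k))" for k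
    by (rule card_UN_disjoint) (auto simp: finite_partitions_into, auto simp: partitions_into_def)
  ultimately show ?thesis
    by (simp add: num_partitions_eq_card finite_partitions_into)
qed

section \<open>Counting the isomorphism classes\<close>

text \<open>The classes are the nonempty fibres of \<open>f\<close>, one for each value.\<close>

lemma card_quotient_kernel:
  assumes "\<And>x y. (x, y) \<in> R \<longleftrightarrow> x \<in> A \<and> y \<in> A \<and> f x = f y"
  shows "card (A // R) = card (f ` A)"
proof -
  have "A // R = (\<lambda>c. {y \<in> A. f y = c}) ` f ` A"
    using assms by (force simp: quotient_def Image_def)
  moreover have "inj_on (\<lambda>c. {y \<in> A. f y = c}) (f ` A)"
    by (rule inj_onI) blast
  ultimately show ?thesis by (simp add: card_image)
qed

theorem theorem2p2:
  fixes n :: nat and G :: "('v, 'e) pre_digraph"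
  assumes "n \<ge> 3"
    and "complete_digraph n G"
    and "infinite (UNIV :: 'a set) \<or> n + 1 \<le> card (UNIV :: 'a set)"
  shows "card (iso_classes {S :: 'a zero_semigroup. zero_divisor_semigroup S \<and> corresponds_to S G})
         = (\<Sum>k = 1..n. \<Sum>t = 0..n - k. num_partitions (n - t) k) + 1"
proof -
  define A where "A = {S :: 'a zero_semigroup. clique_semigroup n S}"
  define type where "type S = block_sizes (carrier S) \<zero>\<^bsub>S\<^esub> (\<lambda>x. x \<cdot>\<^bsub>S\<^esub> x)" for S :: "'a zero_semigroup"
  have sq: "squaring_map (carrier S) \<zero>\<^bsub>S\<^esub> (\<lambda>x. x \<cdot>\<^bsub>S\<^esub> x)" "card (carrier S) = n + 1" if "S \<in> A" for S
    using that squaring_map_square by (auto simp: A_def clique_semigroup_def)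
  have "semigroup_iso S T \<longleftrightarrow> type S = type T" if S: "S \<in> A" and T: "T \<in> A" for S T
    unfolding semigroup_iso_clique_iff[OF S[unfolded A_def mem_Collect_eq] T[unfolded A_def mem_Collect_eq]]
      type_def
    using squaring_map_iso_of_block_sizes[OF sq(1)[OF S] sq(1)[OF T]]
      block_sizes_cong[OF sq(1)[OF S] sq(1)[OF T]] sq(2)[OF S] sq(2)[OF T] by auto
  then have "card (iso_classes A) = card (type ` A)"
    unfolding iso_classes_def by (intro card_quotient_kernel) (auto simp: iso_rel_def)
  also have "type ` A = {M. 0 \<notin># M \<and> sum_mset M \<le> n}"
  proof (intro equalityI subsetI)
    fix M assume "M \<in> {M. 0 \<notin># M \<and> sum_mset M \<le> n}"
    then have M: "0 \<notin># M" "sum_mset M \<le> n" by auto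
    \<comment> \<open>The assumption on the size of \<open>'a\<close> provides room for a carrier of
      \<open>n + 1\<close> elements; one of them is then taken as zero.\<close>
    obtain C :: "'a set" where C: "finite C" "card C = n + 1"
      using assms(3) infinite_arbitrarily_large obtain_subset_with_card_n by (metis finite_UNIV_card_ge_0 )
    then obtain z where z: "z \<in> C" by fastforce
    obtain s where s: "squaring_map C z s" "block_sizes C z s = M"
      using ex_squaring_map_block_sizes[of "C - {z}" z M] C z M by (auto simp: insert_absorb)
    let ?S = "\<lparr>carrier = C, mul = (\<lambda>x y. if x = y then s x else z), zer = z\<rparr>"
    have "?S \<in> A" "type ?S = M"
      using clique_semigroup_of_squaring_map[OF s(1) C(2)] assms(1) s(2) by (auto simp: A_def type_def)
    then show "M \<in> type ` A" by blast
  next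
    fix M assume "M \<in> type ` A"
    then obtain S where "S \<in> A" "M = type S" by blast
    then show "M \<in> {M. 0 \<notin># M \<and> sum_mset M \<le> n}"
      using block_sizes_admissible[OF sq] unfolding type_def by blast
  qed
  also have "A = {S. zero_divisor_semigroup S \<and> corresponds_to S G}"
    unfolding A_def using clique_semigroup_iff[OF assms(2)] by blast
  finally show ?thesis by (simp only: card_bounded_partitions)
qed

end
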